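(* Let $n$ and $k$ be positive integers with $n\ge k+1$, and let $n=q(k+1)+r$ where $q$ and $r$ are the unique integers such that $0\le r\le k$. Then the minimum size of a (finite simple) chordal graph of order $n$ and minimum degree $k$ is $$ q\binom{k+1}{2}+kr-\frac{r(r-1)}{2}. $$
   Context: All graphs are finite and simple. The order of a graph is its number of vertices and its size is its number of edges. A chord of a cycle $C$ in a graph is an edge of the graph not in $E(C)$ both of whose endpoints lie on $C$. A graph is chordal if every cycle of length greater than three has a chord (equivalently, it contains no induced cycle of length greater than three). Chordal graphs are not required to be connected. "Minimum degree $k$" means that the minimum degree is exactly $k$. "The minimum size is $m$" means that every such graph has at least $m$ edges and some such graph has exactly $m$ edges. *)

theory Defs
  imports Complex_Main
begin

definition simple_graph :: "'a set \<Rightarrow> 'a set set \<Rightarrow> bool" where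
  "simple_graph V E \<longleftrightarrow> finite V \<and> (\<forall>e\<in>E. e \<subseteq> V \<and> card e = 2)"

definition degree :: "'a set set \<Rightarrow> 'a \<Rightarrow> nat" where
  "degree E v = card {e \<in> E. v \<in> e}"

(* Only meaningful for finite nonempty V. *)
definition min_degree :: "'a set \<Rightarrow> 'a set set \<Rightarrow> nat" where
  "min_degree V E = Min (degree E ` V)"

(* A cycle is given by the list of its vertices in cyclic order, without repetition of the
   first vertex at the end; its length as a cycle is the length of the list. *)
definition cycle_edges :: "'a list \<Rightarrow> 'a set set" where
  "cycle_edges c = {{c ! i, c ! (Suc i mod length c)} | i. i < length c}"

definition is_cycle :: "'a set set \<Rightarrow> 'a list \<Rightarrow> bool" where
  "is_cycle E c \<longleftrightarrow> length c \<ge> 3 \<and> distinct c \<and> cycle_edges c \<subseteq> E"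

definition is_chord :: "'a set set \<Rightarrow> 'a list \<Rightarrow> 'a set \<Rightarrow> bool" where
  "is_chord E c e \<longleftrightarrow> e \<in> E \<and> e \<notin> cycle_edges c \<and> e \<subseteq> set c"

definition chordal :: "'a set set \<Rightarrow> bool" where
  "chordal E \<longleftrightarrow> (\<forall>c. is_cycle E c \<and> length c > 3 \<longrightarrow> (\<exists>e. is_chord E c e))"

definition chordal_graph_with :: "nat \<Rightarrow> nat \<Rightarrow> 'a set \<Rightarrow> 'a set set \<Rightarrow> bool" where
  "chordal_graph_with n k V E \<longleftrightarrow>
     simple_graph V E \<and> chordal E \<and> card V = n \<and> min_degree V E = k"

end

theory Submission imports Defs begin

text \<open>
  By the handshake lemma, a graph with \<open>n\<close> vertices and minimum degree at least \<open>k\<close> has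
  \<open>2 |E| = k n + \<Sum>\<^sub>v |deg v - k|\<close>, so the claim amounts to \<open>\<Sum>\<^sub>v |deg v - k| \<ge> r (k + 1 - r)\<close>.
  The latter holds for every chordal graph, whatever its degrees, and in this generality it
  is proved by induction. Deleting a clique of size \<open>k + 1\<close> preserves \<open>r\<close> and does not
  increase the sum: inside the clique the excess degrees count exactly the edges that leave it.
  If there is no such clique and the graph is not complete, take a leaf \<open>C\<close> of a clique tree,
  the set \<open>T\<close> of vertices of \<open>C\<close> without neighbours outside \<open>C\<close>, and a vertex \<open>x\<close> outside \<open>C\<close>
  adjacent to all of \<open>C - T\<close>. Joining \<open>x\<close> to \<open>T\<close> keeps the graph chordal and, as the
  vertices of \<open>T\<close> have degree below \<open>k\<close>, does not increase the sum.

  Equality is attained by disjoint cliques of size \<open>k + 1\<close>, the last two of which overlap in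
  \<open>k + 1 - r\<close> vertices.
\<close>

section \<open>Neighbourhoods, cliques and leaf cliques\<close>

definition nbrs :: "('a \<Rightarrow> 'a \<Rightarrow> bool) \<Rightarrow> 'a set \<Rightarrow> 'a \<Rightarrow> 'a set" where
  "nbrs R V v = {u \<in> V. R v u}"

definition clique :: "('a \<Rightarrow> 'a \<Rightarrow> bool) \<Rightarrow> 'a set \<Rightarrow> bool" where
  "clique R C \<longleftrightarrow> (\<forall>x\<in>C. \<forall>y\<in>C. x \<noteq> y \<longrightarrow> R x y)"

text \<open>For finite graphs this is the existence of a perfect elimination ordering, in a form
  that is visibly hereditary.\<close>

definition decomposable :: "('a \<Rightarrow> 'a \<Rightarrow> bool) \<Rightarrow> 'a set \<Rightarrow> bool" where
  "decomposable R V \<longleftrightarrow> (\<forall>U\<subseteq>V. U \<noteq> {} \<longrightarrow> (\<exists>v\<in>U. clique R (nbrs R U v)))"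

text \<open>Absolute values are taken because degrees inside the smaller vertex sets met by the
  induction can fall below \<open>k\<close>.\<close>

definition deviation :: "('a \<Rightarrow> 'a \<Rightarrow> bool) \<Rightarrow> 'a set \<Rightarrow> nat \<Rightarrow> int" where
  "deviation R V k = (\<Sum>v\<in>V. \<bar>int (card (nbrs R V v)) - int k\<bar>)"

lemma finite_nbrs [simp]: "finite V \<Longrightarrow> finite (nbrs R V v)"
  by (simp add: nbrs_def)

lemma clique_subset: "clique R C \<Longrightarrow> D \<subseteq> C \<Longrightarrow> clique R D"
  by (auto simp: clique_def)

lemma decomposable_subset: "decomposable R V \<Longrightarrow> U \<subseteq> V \<Longrightarrow> decomposable R U"
  by (auto simp: decomposable_def)

lemma nbrs_clique: "clique R K \<Longrightarrow> irreflp R \<Longrightarrow> v \<in> K \<Longrightarrow> nbrs R K v = K - {v}"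
  by (auto simp: clique_def nbrs_def irreflp_def)

text \<open>Both sides count the adjacent pairs between \<open>A\<close> and \<open>B\<close>. This
  moves the edges leaving a clique to their outer endpoints.\<close>

lemma sum_card_nbrs_swap:
  assumes "finite A" "finite B" "symp R"
  shows "(\<Sum>a\<in>A. card (nbrs R B a)) = (\<Sum>b\<in>B. card (nbrs R A b))"
proof -
  have c: "card (nbrs R X v) = (\<Sum>u\<in>X. if R v u then 1 else 0)" if "finite X" for X and v :: 'a
    using that by (simp add: nbrs_def flip: sum.inter_filter)
  have s: "R x y = R y x" for x y using \<open>symp R\<close> by (auto dest: sympD)
  have "(\<Sum>a\<in>A. card (nbrs R B a)) = (\<Sum>a\<in>A. \<Sum>b\<in>B. if R a b then 1 else 0)"
    by (simp add: c assms)
  also have "\<dots> = (\<Sum>b\<in>B. \<Sum>a\<in>A. if R a b then 1 else 0)" by (rule sum.swap)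
  also have "\<dots> = (\<Sum>b\<in>B. card (nbrs R A b))" by (simp add: c assms s)
  finally show ?thesis .
qed

text \<open>\<open>C\<close> is a leaf of a clique tree: \<open>T\<close> consists of vertices private to \<open>C\<close>, and \<open>C - T\<close> lies
  in the neighbourhood of \<open>x\<close>.\<close>

lemma leaf_clique:
  assumes "finite V" "symp R" "irreflp R" "decomposable R V" "\<not> clique R V"
  shows "\<exists>T C x. T \<noteq> {} \<and> T \<subseteq> C \<and> C \<subseteq> V \<and> x \<in> V - C \<and> clique R C \<and>
    (\<forall>s\<in>C - T. R x s) \<and> (\<forall>t\<in>T. nbrs R V t = C - {t})"
  using assms(1,4,5)
proof (induction "card V" arbitrary: V rule: less_induct)
  case less
  have s: "R x y = R y x" for x y using \<open>symp R\<close> by (auto dest: sympD)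
  have ir: "\<not> R x x" for x using \<open>irreflp R\<close> by (auto simp: irreflp_def)
  have "V \<noteq> {}" using less.prems(3) by (auto simp: clique_def)
  then obtain v where v: "v \<in> V" and cl: "clique R (nbrs R V v)"
    using less.prems(2) by (auto simp: decomposable_def)
  define Q where "Q = nbrs R V v"
  have Q: "Q \<subseteq> V - {v}" and QR: "\<And>u. u \<in> V \<Longrightarrow> R v u \<longleftrightarrow> u \<in> Q"
    by (auto simp: Q_def nbrs_def ir)
  have clQ: "clique R (insert v Q)"
    using cl s unfolding Q_def[symmetric] by (auto simp: clique_def) (auto simp: Q_def nbrs_def)
  \<comment> \<open>If some \<open>x\<close> outside the closed neighbourhood of the simplicial
    vertex \<open>v\<close> sees all of \<open>Q\<close>, then \<open>v\<close> alone can serve as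
    \<open>T\<close>.\<close>
  have single: ?case if x: "x \<in> V - insert v Q" "\<forall>s\<in>Q. R x s" for x
    using Q QR v clQ x
    by (intro exI[of _ "{v}"] exI[of _ "insert v Q"] exI[of _ x]) (auto simp: nbrs_def)
  show ?case
  proof (cases "clique R (V - {v})")
    case True
    have "\<exists>x. x \<in> V - insert v Q"
    proof (rule ccontr)
      assume "\<nexists>x. x \<in> V - insert v Q"
      then have "V \<subseteq> insert v Q" by auto
      then show False using clQ clique_subset less.prems(3) by blast
    qed
    then obtain x where "x \<in> V - insert v Q" ..
    moreover have "\<forall>s\<in>Q. R x s"
    proof
      fix s assume "s \<in> Q"
      then have "s \<in> V - {v}" "x \<in> V - {v}" "x \<noteq> s" using Q \<open>x \<in> V - insert v Q\<close> by auto
      then show "R x s" using True unfolding clique_def by simp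
    qed
    ultimately show ?thesis by (rule single)
  next
    case False
    have "card (V - {v}) < card V" by (rule card_Diff1_less[OF less.prems(1) v])
    \<comment> \<open>A leaf of \<open>V - {v}\<close> is taken and \<open>v\<close> is put back;
      only the vertices of \<open>Q\<close> gain a neighbour.\<close>
    from less.hyps[OF this _ _ False] obtain T C x where
      T: "T \<noteq> {}" "T \<subseteq> C" "C \<subseteq> V - {v}" "x \<in> V - {v} - C" "clique R C"
      "\<forall>s\<in>C - T. R x s" "\<forall>t\<in>T. nbrs R (V - {v}) t = C - {t}"
      using less.prems decomposable_subset[of R V "V - {v}"] by auto
    have n: "nbrs R V t = (if t \<in> Q then insert v (C - {t}) else C - {t})" if "t \<in> T" for t
    proof -
      have "t \<in> V" using that T by auto
      then have "R t v \<longleftrightarrow> t \<in> Q" using QR s by blast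
      moreover have "nbrs R V t = nbrs R (V - {v}) t \<union> (if R t v then {v} else {})"
        using v by (auto simp: nbrs_def)
      ultimately show ?thesis using T that by auto
    qed
    show ?thesis
    proof (cases "Q \<inter> T = {}")
      case True
      then have "\<forall>t\<in>T. nbrs R V t = C - {t}" using n by auto
      then show ?thesis using T(1-6) by (intro exI[of _ T] exI[of _ C] exI[of _ x]) auto
    next
      case False
      then obtain t where t: "t \<in> Q" "t \<in> T" by auto
      \<comment> \<open>Apart from \<open>v\<close>, all neighbours of \<open>t\<close> lie in
        \<open>C\<close>, and the clique \<open>Q\<close> consists of \<open>t\<close> and
        neighbours of \<open>t\<close>.\<close>
      have QC: "Q \<subseteq> C"
      proof
        fix u assume u: "u \<in> Q"
        show "u \<in> C"
        proof (cases "u = t")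
          case False
          then have "R t u" using u t cl by (auto simp: Q_def clique_def)
          then have "u \<in> nbrs R (V - {v}) t" using u Q by (auto simp: nbrs_def)
          then show ?thesis using T t by auto
        qed (use t T in auto)
      qed
      \<comment> \<open>If \<open>Q = C\<close>, then \<open>v\<close> joins the leaf as a further
        private vertex. Otherwise a vertex of \<open>C - Q\<close> sees all of \<open>Q\<close>, and
        \<open>v\<close> forms a leaf by itself.\<close>
      show ?thesis
      proof (cases "Q = C")
        case True
        have "\<forall>t\<in>insert v T. nbrs R V t = insert v C - {t}"
          using n T True Q_def[symmetric] by auto
        then show ?thesis using T(1-6) clQ True v
          by (intro exI[of _ "insert v T"] exI[of _ "insert v C"] exI[of _ x]) auto
      next
        case False
        then obtain y where "y \<in> C" "y \<notin> Q" using QC by auto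
        then have y: "y \<in> V - insert v Q" using T(3) by auto
        have "R y s" if "s \<in> Q" for s
          using T(5) QC \<open>y \<in> C\<close> \<open>y \<notin> Q\<close> that unfolding clique_def by (metis subsetD)
        then show ?thesis using single[OF y] by simp
      qed
    qed
  qed
qed

section \<open>The lower bound for the deviation\<close>

lemma deviation_lower_bound:
  assumes "finite V" "symp R" "irreflp R" "decomposable R V"
  shows "int (card V mod (k + 1)) * (int k + 1 - int (card V mod (k + 1))) \<le> deviation R V k"
  using assms
\<comment> \<open>The measure is the order plus the number of nonadjacent ordered pairs. Deleting a
  clique lowers the first and does not raise the second; joining \<open>x\<close> to
  \<open>T\<close> keeps the first and lowers the second.\<close>
proof (induction "card V + card {p \<in> V \<times> V. \<not> R (fst p) (snd p)}" arbitrary: V R rule: less_induct)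
  case less
  note fin = less.prems(1)
  have s: "R x y = R y x" for x y using less.prems(2) by (auto dest: sympD)
  have ir: "\<not> R x x" for x using less.prems(3) by (auto simp: irreflp_def)
  show ?case
  proof (cases "\<exists>K\<subseteq>V. clique R K \<and> card K = k + 1")
    case True
    then obtain K where K: "K \<subseteq> V" "clique R K" "card K = k + 1" by auto
    define W where "W = V - K"
    have fK: "finite K" and fW: "finite W" using K fin finite_subset by (auto simp: W_def)
    have VKW: "V = K \<union> W" "K \<inter> W = {}" using K by (auto simp: W_def)
    have cV: "card V = card W + (k + 1)"
      using K fK fW VKW by (simp add: card_Un_disjoint)
    have split: "card (nbrs R V v) = card (nbrs R K v) + card (nbrs R W v)" for v
    proof -
      have "nbrs R V v = nbrs R K v \<union> nbrs R W v" "nbrs R K v \<inter> nbrs R W v = {}"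
        using VKW by (auto simp: nbrs_def)
      then show ?thesis by (simp add: card_Un_disjoint fK fW)
    qed
    have inK: "card (nbrs R K v) = k" if "v \<in> K" for v
      using nbrs_clique[OF K(2) less.prems(3) that] that K(3) fK by simp
    have "deviation R V k = (\<Sum>v\<in>K. \<bar>int (card (nbrs R V v)) - int k\<bar>) + (\<Sum>v\<in>W. \<bar>int (card (nbrs R V v)) - int k\<bar>)"
      unfolding deviation_def by (subst VKW(1), rule sum.union_disjoint) (use fK fW VKW in auto)
    \<comment> \<open>Each vertex of \<open>K\<close> already has \<open>k\<close> neighbours in
      \<open>K\<close>, so its deviation is its number of neighbours in \<open>W\<close>.\<close>
    also have "(\<Sum>v\<in>K. \<bar>int (card (nbrs R V v)) - int k\<bar>) = (\<Sum>v\<in>K. int (card (nbrs R W v)))"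
      by (rule sum.cong) (auto simp: split inK)
    also have "\<dots> = (\<Sum>v\<in>W. int (card (nbrs R K v)))"
      using sum_card_nbrs_swap[OF fK fW less.prems(2)] by (simp flip: of_nat_sum)
    \<comment> \<open>Triangle inequality: for a vertex of \<open>W\<close>, losing its neighbours
      in \<open>K\<close> raises the absolute difference by at most their number.\<close>
    also have "\<dots> + (\<Sum>v\<in>W. \<bar>int (card (nbrs R V v)) - int k\<bar>) \<ge> deviation R W k"
      unfolding deviation_def sum.distrib[symmetric] by (rule sum_mono) (auto simp: split)
    finally have "deviation R W k \<le> deviation R V k" .
    moreover have "card {p \<in> W \<times> W. \<not> R (fst p) (snd p)} \<le> card {p \<in> V \<times> V. \<not> R (fst p) (snd p)}"
      by (rule card_mono) (use fin in \<open>auto simp: W_def\<close>)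
    then have "int (card W mod (k + 1)) * (int k + 1 - int (card W mod (k + 1))) \<le> deviation R W k"
      using less.hyps[of W R] cV fW less.prems decomposable_subset[of R V W] by (auto simp: W_def)
    moreover have "card V mod (k + 1) = card W mod (k + 1)"
      unfolding cV by (rule mod_add_self2)
    ultimately show ?thesis by simp
  next
    case False
    have small: "card C \<le> k" if "C \<subseteq> V" "clique R C" for C
    proof (rule ccontr)
      assume "\<not> card C \<le> k"
      then have "k + 1 \<le> card C" by simp
      then obtain D where "D \<subseteq> C" "card D = k + 1" by (meson obtain_subset_with_card_n)
      then have "D \<subseteq> V" "clique R D" using that clique_subset[of R C D] by auto
      then show False using False \<open>card D = k + 1\<close> by blast
    qed
    show ?thesis
    proof (cases "clique R V")
      case True
      have c: "card V \<le> k" using small True by auto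
      \<comment> \<open>Here \<open>card V\<close> is its own remainder modulo \<open>k + 1\<close>,
        and the bound holds with equality.\<close>
      have "\<bar>int (card (nbrs R V v)) - int k\<bar> = int k + 1 - int (card V)" if "v \<in> V" for v
      proof -
        have "card V \<ge> 1" using that fin card_gt_0_iff[of V] by fastforce
        then show ?thesis using nbrs_clique[OF True less.prems(3) that] that fin c by simp
      qed
      then show ?thesis using c by (simp add: deviation_def)
    next
      case False
      from leaf_clique[OF less.prems False] obtain T C x where
        T: "T \<noteq> {}" "T \<subseteq> C" "C \<subseteq> V" "x \<in> V - C" "clique R C"
        "\<forall>s\<in>C - T. R x s" "\<forall>t\<in>T. nbrs R V t = C - {t}"
        by (elim exE conjE) (rule that)
      define R' where "R' = (\<lambda>a b. R a b \<or> (a = x \<and> b \<in> T) \<or> (b = x \<and> a \<in> T))"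
      have fT: "finite T" "finite C" using T(2,3) fin by (meson finite_subset)+
      have xT: "x \<notin> T" using T by auto
      have xV: "x \<in> V" and TV: "T \<subseteq> V" using T by auto
      have nTx: "\<not> R t x" if "t \<in> T" for t
        using T that by (auto simp: nbrs_def)
      have "symp R'" "irreflp R'" using s ir xT by (auto simp: R'_def symp_def irreflp_def)
      moreover have "decomposable R' V"
        unfolding decomposable_def
      proof (intro allI impI)
        fix U assume U: "U \<subseteq> V" "U \<noteq> {}"
        \<comment> \<open>Only pairs meeting \<open>T\<close> change. Any \<open>t\<close> in
          \<open>U \<inter> T\<close> has its new neighbours in \<open>insert x C\<close>, which the
          added edges have made a clique.\<close>
        show "\<exists>v\<in>U. clique R' (nbrs R' U v)"
        proof (cases "U \<inter> T = {}")
          case True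
          then have eq: "R' a b = R a b" if "a \<in> U" "b \<in> U" for a b using that by (auto simp: R'_def)
          obtain v where v: "v \<in> U" "clique R (nbrs R U v)"
            using less.prems(4) U by (auto simp: decomposable_def)
          then have "nbrs R' U v = nbrs R U v" using eq by (auto simp: nbrs_def)
          moreover have "clique R' (nbrs R U v)" using v by (auto simp: clique_def R'_def)
          ultimately show ?thesis using v(1) by metis
        next
          case False
          then obtain t where t: "t \<in> U" "t \<in> T" by auto
          have "nbrs R' U t \<subseteq> nbrs R V t \<union> {x}" using U t xT by (auto simp: nbrs_def R'_def)
          then have "nbrs R' U t \<subseteq> insert x C" using T t by auto
          moreover have "clique R' (insert x C)"
            using T s by (auto simp: clique_def R'_def)
          ultimately show ?thesis using t clique_subset by blast
        qed
      qed
      moreover have "card {p \<in> V \<times> V. \<not> R' (fst p) (snd p)} < card {p \<in> V \<times> V. \<not> R (fst p) (snd p)}"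
      proof (rule psubset_card_mono)
        obtain t where t: "t \<in> T" using T by auto
        then have "(t, x) \<in> {p \<in> V \<times> V. \<not> R (fst p) (snd p)} - {p \<in> V \<times> V. \<not> R' (fst p) (snd p)}"
          using nTx T by (auto simp: R'_def)
        then show "{p \<in> V \<times> V. \<not> R' (fst p) (snd p)} \<subset> {p \<in> V \<times> V. \<not> R (fst p) (snd p)}"
          unfolding R'_def by blast
      qed (use fin in auto)
      ultimately have IH: "int (card V mod (k + 1)) * (int k + 1 - int (card V mod (k + 1))) \<le> deviation R' V k"
        using less.hyps[of V R'] fin by auto
      \<comment> \<open>\<open>g\<close> bounds the change at each vertex: \<open>x\<close> gains
        \<open>card T\<close> neighbours, while each vertex of \<open>T\<close> moves one closer to
        \<open>k\<close>, its old degree being \<open>card C - 1 < k\<close>. The values of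
        \<open>g\<close> sum to zero.\<close>
      define g where "g v = (if v = x then int (card T) else if v \<in> T then - 1 else 0)" for v
      have "\<bar>int (card (nbrs R' V v)) - int k\<bar> \<le> \<bar>int (card (nbrs R V v)) - int k\<bar> + g v"
        if "v \<in> V" for v
      proof -
        consider "v = x" | "v \<in> T" "v \<noteq> x" | "v \<noteq> x" "v \<notin> T" by blast
        then show ?thesis
        proof cases
          case 1
          have "nbrs R' V x = nbrs R V x \<union> T" "nbrs R V x \<inter> T = {}"
            using TV xT nTx s by (auto simp: nbrs_def R'_def)
          then have "card (nbrs R' V x) = card (nbrs R V x) + card T"
            by (simp add: card_Un_disjoint fin fT)
          then show ?thesis by (simp add: 1 g_def)
        next
          case 2
          have "nbrs R' V v = insert x (nbrs R V v)"
            using xV 2 by (auto simp: nbrs_def R'_def)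
          moreover have "x \<notin> nbrs R V v" using nTx 2 by (simp add: nbrs_def)
          ultimately have "card (nbrs R' V v) = card (nbrs R V v) + 1" by (simp add: fin)
          moreover have "card (nbrs R V v) < k"
          proof -
            have "v \<in> C" using 2 T by auto
            then have "card (C - {v}) < card C" by (rule card_Diff1_less[OF fT(2)])
            then show ?thesis using small[OF T(3,5)] T(7) 2 by simp
          qed
          ultimately show ?thesis using 2 by (simp add: g_def)
        next
          case 3
          then have "nbrs R' V v = nbrs R V v" by (auto simp: nbrs_def R'_def)
          then show ?thesis using 3 by (simp add: g_def)
        qed
      qed
      then have "deviation R' V k \<le> (\<Sum>v\<in>V. \<bar>int (card (nbrs R V v)) - int k\<bar> + g v)"
        unfolding deviation_def by (rule sum_mono)
      also have "\<dots> = deviation R V k + sum g V" by (simp add: deviation_def sum.distrib)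
      also have "sum g V = sum g (insert x T)"
        by (rule sum.mono_neutral_right) (use fin xV TV in \<open>auto simp: g_def\<close>)
      also have "\<dots> = int (card T) + sum g T" using xT fT by (simp add: g_def)
      also have "sum g T = (\<Sum>v\<in>T. - 1)" by (rule sum.cong) (use xT in \<open>auto simp: g_def\<close>)
      finally show ?thesis using IH by simp
    qed
  qed
qed

section \<open>Simplicial vertices in chordal graphs\<close>

text \<open>A walk of least length admits no shortcut, so it neither repeats a vertex nor has an
  edge between nonconsecutive positions.\<close>

lemma shortest_path:
  assumes "\<exists>q. q \<noteq> [] \<and> hd q = s \<and> last q = t \<and> successively R q \<and> set q \<subseteq> X"
  obtains q where "q \<noteq> []" "hd q = s" "last q = t" "successively R q" "set q \<subseteq> X" "distinct q"
    "\<And>i j. i < j \<Longrightarrow> j < length q \<Longrightarrow> R (q ! i) (q ! j) \<Longrightarrow> j = Suc i"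
proof -
  define P where "P q \<longleftrightarrow> q \<noteq> [] \<and> hd q = s \<and> last q = t \<and> successively R q \<and> set q \<subseteq> X" for q
  obtain q where q: "P q" and min: "\<And>p. P p \<Longrightarrow> length q \<le> length p"
    using assms ex_has_least_nat[of P _ length] unfolding P_def by blast
  have adj: "R (q ! i) (q ! Suc i)" if "Suc i < length q" for i
    using q that by (auto simp: P_def successively_conv_nth)
  have shortcut: "P (take (Suc i) q @ drop j q)" if "i < j" "j < length q" "R (q ! i) (q ! j)" for i j
  proof -
    have "last (take (Suc i) q) = q ! i" using that by (simp add: take_Suc_conv_app_nth)
    moreover have "successively R (take (Suc i) q)" "successively R (drop j q)"
      using adj that by (auto simp: successively_conv_nth)
    moreover have "set (take (Suc i) q @ drop j q) \<subseteq> set q"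
      by (auto dest: in_set_takeD in_set_dropD)
    ultimately show ?thesis
      using that q by (auto simp: P_def successively_append_iff hd_drop_conv_nth hd_append)
  qed
  have ind: "j = Suc i" if "i < j" "j < length q" "R (q ! i) (q ! j)" for i j
    using min[OF shortcut[OF that]] that by auto
  have "distinct q"
  proof (rule ccontr)
    assume "\<not> distinct q"
    then obtain i j where ij: "i < j" "j < length q" "q ! i = q ! j"
      by (metis distinct_conv_nth linorder_neqE_nat)
    \<comment> \<open>A repetition at the start allows the prefix to be dropped; a later one makes
      the predecessor of \<open>q ! i\<close> adjacent to \<open>q ! j\<close>, a shortcut.\<close>
    show False
    proof (cases i)
      case 0
      have "P (drop j q)" using ij 0 q
        by (auto simp: P_def hd_drop_conv_nth hd_conv_nth successively_conv_nth dest: in_set_dropD)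
      then show False using min[of "drop j q"] ij by auto
    next
      case (Suc m)
      then have "R (q ! m) (q ! j)" using adj[of m] ij by auto
      then show False using ind[of m j] Suc ij by auto
    qed
  qed
  with q ind that show ?thesis unfolding P_def by blast
qed

text \<open>Otherwise a shortest path from \<open>s\<close> to \<open>t\<close> through
  \<open>X\<close> has at least three vertices, and \<open>b\<close> closes it to a cycle of length
  at least four. A chord cannot end in \<open>b\<close>, which sees only \<open>s\<close> and
  \<open>t\<close> on the path, nor join two vertices of the induced path.\<close>

lemma chordal_path_adjacent:
  assumes ch: "chordal E" and c2: "\<forall>e\<in>E. card e = 2"
    and q: "q \<noteq> []" "hd q = s" "last q = t" "successively (\<lambda>u v. {u, v} \<in> E) q" "set q \<subseteq> insert s (insert t X)"
    and b: "{b, s} \<in> E" "{b, t} \<in> E" "b \<notin> X" "\<forall>x\<in>X. {b, x} \<notin> E"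
    and st: "s \<noteq> t"
  shows "{s, t} \<in> E"
proof (rule ccontr)
  assume nst: "{s, t} \<notin> E"
  let ?R = "\<lambda>u v. {u, v} \<in> E"
  obtain p where p: "p \<noteq> []" "hd p = s" "last p = t" "successively ?R p" "set p \<subseteq> insert s (insert t X)" "distinct p"
    and ind: "\<And>i j. i < j \<Longrightarrow> j < length p \<Longrightarrow> ?R (p ! i) (p ! j) \<Longrightarrow> j = Suc i"
    using shortest_path[of s t ?R "insert s (insert t X)"] q by blast
  have ne: "x \<noteq> y" if "{x, y} \<in> E" for x y using c2 that by force
  have bp: "b \<notin> set p" using p(5) b ne by auto
  define n where "n = length p"
  have p0: "p ! 0 = s" and pl: "p ! (n - 1) = t" using p by (auto simp: n_def hd_conv_nth last_conv_nth)
  have n3: "n \<ge> 3"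
  proof -
    have "n \<noteq> 0" using p by (auto simp: n_def)
    moreover have "n \<noteq> 1" using p0 pl st by auto
    moreover have "n \<noteq> 2"
    proof
      assume "n = 2"
      then have "?R (p ! 0) (p ! 1)" using p(4) by (auto simp: n_def successively_conv_nth)
      then show False using p0 pl nst \<open>n = 2\<close> by auto
    qed
    ultimately show ?thesis by linarith
  qed
  have pj: "?R (p ! i) (p ! Suc i)" if "Suc i < n" for i
    using p(4) that by (auto simp: n_def successively_conv_nth)
  have bj: "j = 0 \<or> j = n - 1" if "j < n" "{b, p ! j} \<in> E" for j
  proof -
    have "p ! j \<in> insert s (insert t X)" using that p(5) by (auto simp: n_def subset_iff)
    then have "p ! j = s \<or> p ! j = t" using b that by auto
    moreover have "i = j" if "i < n" "p ! i = p ! j" for i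
      using that \<open>j < n\<close> p(6) by (simp add: n_def nth_eq_iff_index_eq)
    ultimately show ?thesis using p0 pl n3 by (metis diff_less less_le_trans zero_less_numeral zero_less_one)
  qed
  let ?c = "b # p"
  have len: "length ?c = Suc n" by (simp add: n_def)
  have "is_cycle E ?c"
    unfolding is_cycle_def cycle_edges_def
  proof (intro conjI subsetI)
    fix e assume "e \<in> {{?c ! i, ?c ! (Suc i mod length ?c)} |i. i < length ?c}"
    then obtain i where i: "i < Suc n" "e = {?c ! i, ?c ! (Suc i mod Suc n)}" unfolding len by auto
    consider "i = 0" | m where "i = Suc m" "Suc m < n" | "i = n"
      using i(1) by (metis less_SucE not0_implies_Suc)
    then show "e \<in> E"
    proof cases
      case 1 then show ?thesis using i n3 p0 b by simp
    next
      case 2 then show ?thesis using i pj[of m] by simp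
    next
      case 3
      then have "e = {p ! (n - 1), b}" using i n3 by (simp add: nth_Cons')
      then show ?thesis using pl b by (simp add: insert_commute)
    qed
  qed (use n3 p bp in \<open>auto simp: n_def\<close>)
  moreover have "length ?c > 3" using len n3 by simp
  ultimately obtain e where "is_chord E ?c e" using ch unfolding chordal_def by blast
  then have e: "e \<in> E" "e \<notin> cycle_edges ?c" "e \<subseteq> set ?c" by (auto simp: is_chord_def)
  have edge: "{?c ! i, ?c ! (Suc i mod Suc n)} \<in> cycle_edges ?c" if "i < Suc n" for i
    unfolding cycle_edges_def len using that by blast
  obtain u v where uv: "e = {u, v}" "u \<noteq> v" using c2 e by (metis card_2_iff)
  \<comment> \<open>Position 0 of \<open>b # p\<close> is \<open>b\<close>, and position
    \<open>Suc m\<close> is \<open>p ! m\<close>. Both kinds of possible chord turn out to be cycle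
    edges.\<close>
  have key: "False" if ij: "e = {?c ! i, ?c ! j}" "i < j" "j < Suc n" for i j
  proof -
    obtain j' where j': "j = Suc j'" using ij by (cases j) auto
    show False
    proof (cases i)
      case 0
      then have "j' = 0 \<or> j' = n - 1" using bj[of j'] that e j' by auto
      then show False
      proof
        assume "j' = 0"
        then show False using edge[of 0] that e j' 0 n3 by simp
      next
        assume "j' = n - 1"
        then have "j = n" using j' n3 by auto
        then show False using edge[of n] that e 0 by (simp add: insert_commute)
      qed
    next
      case (Suc i')
      then have "j' = Suc i'" using ind[of i' j'] that e j' by (auto simp: n_def)
      then show False using edge[of i] that e j' Suc by simp
    qed
  qed
  obtain i where i: "i < Suc n" "?c ! i = u" using e uv len by (metis in_set_conv_nth insert_subset)
  obtain j where j: "j < Suc n" "?c ! j = v" using e uv len by (metis in_set_conv_nth insert_subset)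
  have "i \<noteq> j" using i j uv by auto
  then show False using key[of i j] key[of j i] i j uv by (metis insert_commute linorder_neqE_nat)
qed

definition connected_on :: "('a \<Rightarrow> 'a \<Rightarrow> bool) \<Rightarrow> 'a set \<Rightarrow> bool" where
  "connected_on R A \<longleftrightarrow> (\<forall>x\<in>A. \<forall>y\<in>A. (\<lambda>u v. u \<in> A \<and> v \<in> A \<and> R u v)\<^sup>*\<^sup>* x y)"

lemma connected_on_path:
  assumes "connected_on R A" "x \<in> A" "y \<in> A"
  shows "\<exists>p. p \<noteq> [] \<and> hd p = x \<and> last p = y \<and> successively R p \<and> set p \<subseteq> A"
proof -
  have "(\<lambda>u v. u \<in> A \<and> v \<in> A \<and> R u v)\<^sup>*\<^sup>* x y" using assms by (auto simp: connected_on_def)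
  then show ?thesis
  proof (induction rule: rtranclp_induct)
    case base
    show ?case using assms by (intro exI[of _ "[x]"]) auto
  next
    case (step y z)
    then obtain p where "p \<noteq> []" "hd p = x" "last p = y" "successively R p" "set p \<subseteq> A" by auto
    then show ?case using step by (intro exI[of _ "p @ [z]"]) (auto simp: successively_append_iff)
  qed
qed

lemma connected_on_insert:
  assumes "connected_on R A" "symp R" "a \<in> A" "R a s"
  shows "connected_on R (insert s A)"
proof -
  let ?S = "\<lambda>u v. u \<in> insert s A \<and> v \<in> insert s A \<and> R u v"
  have "?S\<^sup>*\<^sup>* x y" if "x \<in> A" "y \<in> A" for x y
  proof -
    have "(\<lambda>u v. u \<in> A \<and> v \<in> A \<and> R u v)\<^sup>*\<^sup>* x y" using assms(1) that by (auto simp: connected_on_def)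
    then show ?thesis by (rule rtranclp_mono[THEN predicate2D, rotated]) auto
  qed
  moreover have "?S a s" "?S s a" using assms by (auto dest: sympD)
  ultimately have "?S\<^sup>*\<^sup>* x a \<and> ?S\<^sup>*\<^sup>* a x" if "x \<in> insert s A" for x
    using that assms(3) by (metis (no_types, lifting) insertE r_into_rtranclp)
  then show ?thesis unfolding connected_on_def by (blast intro: rtranclp_trans[of _ _ a])
qed

text \<open>Dirac's theorem that a chordal graph has a simplicial vertex, proved for all induced
  subgraphs at once.\<close>

lemma chordal_decomposable:
  assumes g: "simple_graph V E" and ch: "chordal E"
  shows "decomposable (\<lambda>u v. {u, v} \<in> E) V"
proof -
  let ?R = "\<lambda>u v. {u, v} \<in> E"
  have c2: "\<forall>e\<in>E. card e = 2" using g by (auto simp: simple_graph_def)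
  have ne: "x \<noteq> y" if "{x, y} \<in> E" for x y using c2 that by force
  have sy: "symp ?R" by (auto simp: symp_def insert_commute)
  have s: "?R x y = ?R y x" for x y by (simp add: insert_commute)
  have "\<exists>v\<in>U. clique ?R (nbrs ?R U v)" if "finite U" "U \<noteq> {}" for U
    using that
  proof (induction "card U" arbitrary: U rule: less_induct)
    case less
    show ?case
    proof (cases "clique ?R U")
      case True
      then have "clique ?R (nbrs ?R U v)" for v
        by (rule clique_subset) (auto simp: nbrs_def)
      then show ?thesis using less.prems by auto
    next
      case False
      then obtain a b where ab: "a \<in> U" "b \<in> U" "a \<noteq> b" "\<not> ?R a b" by (auto simp: clique_def)
      \<comment> \<open>Take a maximal connected \<open>A\<close> that does not dominate \<open>U\<close>. By maximality its boundary \<open>S\<close>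
        is completely joined to the remainder \<open>B\<close>, and \<open>S\<close> is a clique because two nonadjacent
        vertices of \<open>S\<close> would lie on a chordless cycle through \<open>A\<close> and a vertex of \<open>B\<close>. Hence a
        simplicial vertex of \<open>B\<close> is simplicial in \<open>U\<close>.\<close>
      define far where "far A = {b \<in> U - A. \<forall>a\<in>A. \<not> ?R a b}" for A
      define P where "P A \<longleftrightarrow> A \<noteq> {} \<and> A \<subseteq> U \<and> connected_on ?R A \<and> far A \<noteq> {}" for A
      have "b \<in> far {a}" using ab by (auto simp: far_def)
      then have "P {a}" using ab by (auto simp: P_def connected_on_def)
      moreover have "finite {A. P A}"
        by (rule finite_subset[of _ "Pow U"]) (use less.prems in \<open>auto simp: P_def\<close>)
      ultimately obtain A where A: "P A" and max: "\<And>A'. P A' \<Longrightarrow> A \<subseteq> A' \<Longrightarrow> A' = A"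
        using finite_has_maximal[of "{A. P A}"] by blast
      define B where "B = far A"
      define S where "S = U - A - B"
      have B: "B \<noteq> {}" "B \<subseteq> U" "A \<subseteq> U" "A \<noteq> {}" "connected_on ?R A" using A by (auto simp: P_def B_def far_def)
      have BA: "\<not> ?R a b" if "a \<in> A" "b \<in> B" for a b using that by (auto simp: B_def far_def)
      have SA: "\<exists>a\<in>A. ?R a s" if "s \<in> S" for s using that by (auto simp: S_def B_def far_def)
      have SB: "?R s b" if sb: "s \<in> S" "b \<in> B" for s b
      proof (rule ccontr)
        assume n: "\<not> ?R s b"
        obtain a where "a \<in> A" "?R a s" using SA sb by blast
        then have "connected_on ?R (insert s A)" using connected_on_insert B sy by fastforce
        moreover have "b \<in> far (insert s A)" using n sb by (auto simp: B_def far_def S_def)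
        ultimately have "P (insert s A)" using sb B by (auto simp: P_def S_def)
        then show False using max[of "insert s A"] sb by (auto simp: S_def)
      qed
      have clS: "clique ?R S"
        unfolding clique_def
      proof (intro ballI impI)
        fix u v assume uv: "u \<in> S" "v \<in> S" "u \<noteq> v"
        obtain a a' where a: "a \<in> A" "?R a u" "a' \<in> A" "?R a' v" using SA uv by blast
        obtain p where p: "p \<noteq> []" "hd p = a" "last p = a'" "successively ?R p" "set p \<subseteq> A"
          using connected_on_path[of ?R A a a'] B a by blast
        obtain b where b: "b \<in> B" using B by auto
        have bA: "b \<notin> A" using b by (auto simp: B_def far_def)
        show "{u, v} \<in> E"
        proof (rule chordal_path_adjacent[OF ch c2, of "u # p @ [v]" u v A b])
          show "successively ?R (u # p @ [v])"
            using p a s by (auto simp: successively_append_iff successively_Cons)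
          show "{b, u} \<in> E" "{b, v} \<in> E" using SB b uv s by blast+
          show "\<forall>x\<in>A. {b, x} \<notin> E" using BA b s by blast
        qed (use p uv bA in auto)
      qed
      have "card B < card U"
        by (rule psubset_card_mono) (use less.prems B in \<open>auto simp: B_def far_def\<close>)
      then obtain v where v: "v \<in> B" "clique ?R (nbrs ?R B v)"
        using less.hyps[of B] B less.prems finite_subset by metis
      \<comment> \<open>No neighbour of \<open>v\<close> lies in \<open>A\<close>, so only
        \<open>B\<close> and \<open>S\<close> contribute.\<close>
      have "nbrs ?R U v \<subseteq> nbrs ?R B v \<union> S"
        using BA v s by (auto simp: nbrs_def S_def)
      moreover have "clique ?R (nbrs ?R B v \<union> S)"
        unfolding clique_def
      proof (intro ballI impI)
        fix x y assume xy: "x \<in> nbrs ?R B v \<union> S" "y \<in> nbrs ?R B v \<union> S" "x \<noteq> y"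
        have "x \<in> B \<or> x \<in> S" "y \<in> B \<or> y \<in> S" using xy by (auto simp: nbrs_def)
        then show "?R x y" using v(2) clS SB s xy unfolding clique_def by (metis Un_iff)
      qed
      ultimately show ?thesis using v B clique_subset by blast
    qed
  qed
  then show ?thesis using g finite_subset unfolding decomposable_def simple_graph_def by metis
qed

section \<open>Degrees and the size bound\<close>

lemma degree_eq_card_nbrs:
  assumes "simple_graph V E"
  shows "degree E v = card (nbrs (\<lambda>u w. {u, w} \<in> E) V v)"
proof -
  have "{e \<in> E. v \<in> e} = (\<lambda>u. {v, u}) ` nbrs (\<lambda>u w. {u, w} \<in> E) V v"
  proof (intro set_eqI iffI)
    fix e assume "e \<in> {e \<in> E. v \<in> e}"
    then have e: "e \<in> E" "v \<in> e" "card e = 2" "e \<subseteq> V" using assms by (auto simp: simple_graph_def)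
    then obtain u where "e = {v, u}" by (auto simp: card_2_iff)
    then show "e \<in> (\<lambda>u. {v, u}) ` nbrs (\<lambda>u w. {u, w} \<in> E) V v" using e by (auto simp: nbrs_def)
  qed (auto simp: nbrs_def)
  moreover have "inj_on (\<lambda>u. {v, u}) A" for A by (auto simp: inj_on_def doubleton_eq_iff)
  ultimately show ?thesis by (simp add: degree_def card_image)
qed

lemma handshake:
  assumes "simple_graph V E"
  shows "(\<Sum>v\<in>V. degree E v) = 2 * card E"
proof -
  have e: "e \<subseteq> V" "card e = 2" if "e \<in> E" for e
    using assms that by (auto simp: simple_graph_def)
  have fin: "finite V" "finite E"
    using assms finite_subset[of E "Pow V"] by (auto simp: simple_graph_def)
  have "card {v \<in> V. v \<in> e} = 2" if "e \<in> E" for e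
  proof -
    have "{v \<in> V. v \<in> e} = e" using e[OF that] by auto
    then show ?thesis using e[OF that] by simp
  qed
  then have "(\<Sum>v\<in>V. card {e \<in> E. v \<in> e}) = (\<Sum>e\<in>E. 2)"
    using sum_multicount_gen[of V E "\<lambda>v e. v \<in> e" "\<lambda>_. 2"] fin by simp
  then show ?thesis by (simp add: degree_def)
qed

text \<open>With no degree below \<open>k\<close> the absolute values disappear, and by the
  handshake lemma the deviation is \<open>2 * card E - k * card V\<close>.\<close>

lemma chordal_size_lower_bound:
  assumes g: "simple_graph V E" and "chordal E" and deg: "\<And>v. v \<in> V \<Longrightarrow> k \<le> degree E v"
  defines "r \<equiv> card V mod (k + 1)"
  shows "int k * int (card V) + int r * (int k + 1 - int r) \<le> 2 * int (card E)"
proof -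
  let ?R = "\<lambda>u v. {u, v} \<in> E"
  have "symp ?R" by (auto simp: symp_def insert_commute)
  moreover have "irreflp ?R" using g by (fastforce simp: irreflp_def simple_graph_def)
  moreover have "finite V" using g by (simp add: simple_graph_def)
  ultimately have "int r * (int k + 1 - int r) \<le> deviation ?R V k"
    unfolding r_def using deviation_lower_bound chordal_decomposable[OF assms(1,2)] by blast
  also have "deviation ?R V k = (\<Sum>v\<in>V. int (degree E v) - int k)"
    unfolding deviation_def by (rule sum.cong) (use deg in \<open>auto simp: degree_eq_card_nbrs[OF g]\<close>)
  also have "\<dots> = 2 * int (card E) - int (card V) * int k"
    using handshake[OF g] by (simp add: sum_subtractf flip: of_nat_sum)
  finally show ?thesis by (simp add: mult.commute)
qed

section \<open>The extremal graphs\<close>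

text \<open>The two cycle neighbours of the least vertex of a cycle are both larger, hence adjacent,
  and their edge is a chord.\<close>

lemma chordal_if_elimination_order:
  fixes E :: "'a::linorder set set"
  assumes c2: "\<forall>e\<in>E. card e = 2"
    and elim: "\<And>v x y. \<lbrakk>{v, x} \<in> E; {v, y} \<in> E; v < x; v < y; x \<noteq> y\<rbrakk> \<Longrightarrow> {x, y} \<in> E"
  shows "chordal E"
  unfolding chordal_def
proof (intro allI impI)
  fix c assume c: "is_cycle E c \<and> length c > 3"
  define n where "n = length c"
  have dist: "distinct c" and edge: "\<And>i. i < n \<Longrightarrow> {c ! i, c ! (Suc i mod n)} \<in> E" and n: "n > 3"
    using c by (auto simp: is_cycle_def cycle_edges_def n_def)
  have inj: "c ! i = c ! j \<longleftrightarrow> i = j" if "i < n" "j < n" for i j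
    using that dist by (simp add: n_def nth_eq_iff_index_eq)
  have "Min (set c) \<in> set c" using n by (intro Min_in) (auto simp: n_def)
  then obtain i where i: "i < n" "c ! i = Min (set c)" by (auto simp: in_set_conv_nth n_def)
  define s where "s = (if Suc i = n then 0 else Suc i)"
  define p where "p = (if i = 0 then n - 1 else i - 1)"
  have sp: "s < n" "p < n" "s \<noteq> p" "s \<noteq> i" "p \<noteq> i" "Suc i mod n = s" "Suc p mod n = i"
    using i n by (auto simp: s_def p_def)
  have less: "c ! i < c ! j" if "j < n" "j \<noteq> i" for j
    using that i inj[of i j] Min_le[of "set c" "c ! j"] by (auto simp: n_def less_le)
  have "{c ! i, c ! s} \<in> E" "{c ! i, c ! p} \<in> E"
    using edge[of i] edge[of p] i sp by (auto simp: insert_commute)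
  then have "{c ! s, c ! p} \<in> E" using elim less sp inj by metis
  moreover have "{c ! s, c ! p} \<notin> cycle_edges c"
  proof
    assume "{c ! s, c ! p} \<in> cycle_edges c"
    then obtain j where j: "j < n" "{c ! s, c ! p} = {c ! j, c ! (Suc j mod n)}"
      by (auto simp: cycle_edges_def n_def)
    \<comment> \<open>Positions \<open>s\<close> and \<open>p\<close> lie on either side of
      \<open>i\<close>; they could be consecutive only in a cycle of length three.\<close>
    then have "s = j \<and> p = Suc j mod n \<or> s = Suc j mod n \<and> p = j"
      using sp inj n by (auto simp: doubleton_eq_iff)
    moreover have "Suc j mod n = (if Suc j = n then 0 else Suc j)" using j n by auto
    ultimately show False using i n j by (auto simp: s_def p_def split: if_splits)
  qed
  ultimately show "\<exists>e. is_chord E c e"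
    using sp by (intro exI[of _ "{c ! s, c ! p}"]) (auto simp: is_chord_def n_def)
qed

text \<open>The blocks are \<open>{0..<a}, {a..<2a}, \<dots>\<close>, the last one possibly incomplete; in addition the
  last \<open>a\<close> vertices form a clique.\<close>

definition window_adj :: "nat \<Rightarrow> nat \<Rightarrow> nat \<Rightarrow> nat \<Rightarrow> bool" where
  "window_adj a n i j \<longleftrightarrow> i \<noteq> j \<and> (i div a = j div a \<or> n \<le> i + a \<and> n \<le> j + a)"

definition window_edges :: "nat \<Rightarrow> nat \<Rightarrow> nat set set" where
  "window_edges a n = {{i, j} | i j. i < n \<and> j < n \<and> window_adj a n i j}"

lemma in_window_edges: "{i, j} \<in> window_edges a n \<longleftrightarrow> i < n \<and> j < n \<and> window_adj a n i j"
  by (auto simp: window_edges_def window_adj_def doubleton_eq_iff)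

lemma simple_graph_window: "simple_graph {..<n} (window_edges a n)"
  by (auto simp: simple_graph_def window_edges_def window_adj_def)

text \<open>All vertices above one of the last \<open>a\<close> vertices are again among these; any
  other vertex has all its neighbours in its own block. Either way the larger neighbours form a
  clique.\<close>

lemma chordal_window: "chordal (window_edges a n)"
proof (rule chordal_if_elimination_order)
  show "\<forall>e\<in>window_edges a n. card e = 2"
    using simple_graph_window[of n a] by (simp add: simple_graph_def)
  show "{x, y} \<in> window_edges a n"
    if "{v, x} \<in> window_edges a n" "{v, y} \<in> window_edges a n" "v < x" "v < y" "x \<noteq> y" for v x y
    using that by (auto simp: in_window_edges window_adj_def)
qed

text \<open>There are \<open>p + 1\<close> full blocks and a rest of size \<open>r\<close>. The last
  \<open>k + 1\<close> vertices start at \<open>p * (k + 1) + r\<close>, so they share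
  \<open>k + 1 - r\<close> vertices with the last full block. A shared vertex sees the
  \<open>k + 1 + r\<close> vertices of both cliques, any other only one clique of size
  \<open>k + 1\<close>.\<close>

lemma degree_window:
  assumes "i < n" "n = p * (k + 1) + (k + 1) + r" "r \<le> k"
  shows "degree (window_edges (k + 1) n) i
    = k + (if p * (k + 1) + r \<le> i \<and> i < p * (k + 1) + (k + 1) then r else 0)"
proof -
  define a where "a = k + 1"
  have n: "n = p * a + a + r" and a: "a > 0" "r < a" using assms by (auto simp: a_def)
  have D: "j div a = b \<longleftrightarrow> b * a \<le> j \<and> j < b * a + a" for j b
    using a by (metis add.commute div_nat_eqI div_times_less_eq_dividend dividend_less_times_div
        mult.commute mult_Suc_right)
  let ?N = "nbrs (\<lambda>u w. {u, w} \<in> window_edges a n) {..<n} i"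
  have N: "?N = {j. j < n \<and> i \<noteq> j \<and> (i div a = j div a \<or> n \<le> i + a \<and> n \<le> j + a)}"
    using assms(1) by (auto simp: nbrs_def in_window_edges window_adj_def)
  have N': "?N = {j. j < n \<and> i \<noteq> j \<and> (b * a \<le> j \<and> j < b * a + a \<or> n \<le> i + a \<and> n \<le> j + a)}"
    if "i div a = b" for b
    unfolding N that by (rule Collect_cong) (metis D)
  have "card ?N = k + (if p * a + r \<le> i \<and> i < p * a + a then r else 0)"
  proof -
    consider "i < p * a + r" | "p * a + r \<le> i" "i < p * a + a" | "p * a + a \<le> i" by linarith
    then show ?thesis
    proof cases
      case 1
      define b where "b = i div a"
      have ib: "b * a \<le> i" "i < b * a + a" using D[of i b] by (auto simp: b_def)
      \<comment> \<open>Block \<open>b\<close> is thus one of the full blocks and lies entirely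
        below \<open>n\<close>.\<close>
      have "b * a < (p + 1) * a" using ib 1 a by simp
      then have "b \<le> p" by (simp only: mult_less_cancel2) simp
      then have "b * a \<le> p * a" by simp
      then have lt: "x < n" if "x < b * a + a" for x using that n by linarith
      then have "?N = {b * a..<b * a + a} - {i}"
        unfolding N'[OF b_def[symmetric]] using lt 1 n by auto
      then show ?thesis using ib 1 by (simp add: a_def)
    next
      case 2
      have "i div a = p" using D[of i p] 2 by simp
      then have "?N = {p * a..<n} - {i}"
        unfolding N'[OF \<open>i div a = p\<close>] using 2 n by auto
      then show ?thesis using 2 n assms(1) by (simp add: a_def)
    next
      case 3
      have "i div a = p + 1" using D[of i "p + 1"] 3 n a assms(1) by simp
      then have "?N = {p * a + r..<n} - {i}"
        unfolding N'[OF \<open>i div a = p + 1\<close>] using 3 n a by auto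
      then show ?thesis using 3 n a assms(1) by (simp add: a_def)
    qed
  qed
  then show ?thesis using degree_eq_card_nbrs[OF simple_graph_window, of a n i] by (simp add: a_def)
qed

text \<open>Only the \<open>k + 1 - r\<close> shared vertices have degree above \<open>k\<close>,
  each by \<open>r\<close>.\<close>

lemma card_window_edges:
  assumes "n = p * (k + 1) + (k + 1) + r" "r \<le> k"
  shows "2 * card (window_edges (k + 1) n) = k * n + r * (k + 1 - r)"
proof -
  let ?b = "p * (k + 1)"
  have "2 * card (window_edges (k + 1) n) = (\<Sum>i<n. degree (window_edges (k + 1) n) i)"
    using handshake[OF simple_graph_window] by simp
  also have "\<dots> = (\<Sum>i<n. k + (if i \<in> {?b + r..<?b + (k + 1)} then r else 0))"
    by (rule sum.cong) (use degree_window assms in auto)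
  also have "\<dots> = k * n + (\<Sum>i\<in>{..<n} \<inter> {?b + r..<?b + (k + 1)}. r)"
    by (simp only: sum.distrib sum.inter_restrict[OF finite_lessThan]) simp
  also have "{..<n} \<inter> {?b + r..<?b + (k + 1)} = {?b + r..<?b + (k + 1)}"
    using assms by auto
  finally show ?thesis by (simp add: mult.commute)
qed

lemma min_degree_window:
  assumes "n = p * (k + 1) + (k + 1) + r" "r \<le> k"
  shows "min_degree {..<n} (window_edges (k + 1) n) = k"
  unfolding min_degree_def
proof (rule Min_eqI)
  have "n > 0" using assms by simp
  \<comment> \<open>Vertex 0 is shared only if \<open>p = 0\<close> and \<open>r = 0\<close>, and
    then the excess \<open>r\<close> vanishes.\<close>
  then have "degree (window_edges (k + 1) n) 0 = k" using degree_window[of 0 n p k r] assms by auto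
  then show "k \<in> degree (window_edges (k + 1) n) ` {..<n}" using \<open>n > 0\<close> by force
qed (use degree_window assms in auto)

theorem theorem4:
  fixes n k q r :: nat
  assumes "n \<ge> 1" and "k \<ge> 1" and "n \<ge> k + 1"
    and "n = q * (k + 1) + r" and "r \<le> k"
  shows "(\<forall>(V :: 'a set) E. chordal_graph_with n k V E \<longrightarrow>
            real (card E) \<ge> real q * real ((k + 1) choose 2) + real k * real r
                            - real r * (real r - 1) / 2) \<and>
         (\<exists>(V :: nat set) E. chordal_graph_with n k V E \<and>
            real (card E) = real q * real ((k + 1) choose 2) + real k * real r
                            - real r * (real r - 1) / 2)"
proof -
  have "2 * ((k + 1) choose 2) = (k + 1) * k" by (simp add: choose_two)
  then have ch: "2 * real ((k + 1) choose 2) = (real k + 1) * real k"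
    by (metis of_nat_1 of_nat_add of_nat_mult of_nat_numeral)
  \<comment> \<open>Substituting \<open>n = q * (k + 1) + r\<close> turns the stated formula into
    the half degree sum of the bound.\<close>
  have size: "real q * real ((k + 1) choose 2) + real k * real r - real r * (real r - 1) / 2
    = (real k * real n + real r * (real k + 1 - real r)) / 2"
  proof -
    have "real q * (2 * real ((k + 1) choose 2)) + 2 * real k * real r - real r * (real r - 1)
      = real k * real n + real r * (real k + 1 - real r)"
      unfolding ch using assms(4) by (simp add: algebra_simps)
    then show ?thesis by (simp add: field_simps)
  qed
  have r: "n mod (k + 1) = r"
    using assms(5) by (simp only: assms(4) mod_mult_self3) simp
  have "(real k * real n + real r * (real k + 1 - real r)) / 2 \<le> real (card E)"
    if "chordal_graph_with n k V E" for V :: "'a set" and E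
  proof -
    have g: "simple_graph V E" "chordal E" "card V = n" "min_degree V E = k"
      using that by (auto simp: chordal_graph_with_def)
    have "k \<le> degree E v" if "v \<in> V" for v
      using g that by (auto simp: min_degree_def simple_graph_def)
    then have "int k * int n + int r * (int k + 1 - int r) \<le> 2 * int (card E)"
      using chordal_size_lower_bound[OF g(1,2)] g(3) r by metis
    then have "real_of_int (int k * int n + int r * (int k + 1 - int r)) \<le> real_of_int (2 * int (card E))"
      by (simp only: of_int_le_iff)
    then show ?thesis by simp
  qed
  moreover have "\<exists>(V :: nat set) E. chordal_graph_with n k V E \<and>
    real (card E) = (real k * real n + real r * (real k + 1 - real r)) / 2"
  proof -
    \<comment> \<open>As \<open>n\<close> exceeds \<open>k\<close>, there is a full block to overlap
      with the last \<open>k + 1\<close> vertices.\<close>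
    have "q \<noteq> 0" using assms by (intro notI) simp
    then obtain p where "q = Suc p" using not0_implies_Suc by blast
    then have n: "n = p * (k + 1) + (k + 1) + r" using assms(4) by simp
    have "real (2 * card (window_edges (k + 1) n)) = real (k * n + r * (k + 1 - r))"
      using card_window_edges[OF n assms(5)] by simp
    then have "real (card (window_edges (k + 1) n))
      = (real k * real n + real r * (real k + 1 - real r)) / 2"
      using assms(5) by (simp add: of_nat_diff field_simps)
    moreover have "chordal_graph_with n k {..<n} (window_edges (k + 1) n)"
      using simple_graph_window chordal_window min_degree_window[OF n assms(5)]
      by (simp add: chordal_graph_with_def)
    ultimately show ?thesis by blast
  qed
  ultimately show ?thesis unfolding size by blast
qed

end
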